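(* Let $\mathcal N$ be a curve in $\mathbb C^2$ (with coordinates $(u,v)$), let $(\Delta,p)$ be a proper Riemann domain over $\mathbb C^2\setminus\mathcal N$, let $F$ be a meromorphic function on $\Delta$ which is holomorphic outside a curve $\mathcal M\subset\Delta$, let $X_0\in\Delta\setminus\mathcal M$, and put $(u_0,v_0)=p(X_0)$. Let $\eta$ be a local inverse of $p$ with $\eta(u_0,v_0)=X_0$, defined in a bidisc $\mathbb D_1\times\mathbb D_2$ around $(u_0,v_0)$ on which $F\circ\eta$ is holomorphic. Let $u:\mathbb D(v_0,r)\to\mathbb D_1$ be the holomorphic solution of the Cauchy problem $$u'(v)=F\circ\eta\,(u(v),v),\qquad u(v_0)=u_0,$$ where $r>0$ is a radius as provided by the local existence-and-uniqueness theorem recalled in the context. Set $\mathcal A=\mathcal N\cup p(\mathcal M)$. Suppose that $\mathcal A$ is algebraic. Let $\gamma:[0,1]\to\mathbb C$ be an embedded $C^1$ arc with $\gamma(0)=v_0$ such that, for each $t\in[0,1]$, the complex line $\{(u,v)\in\mathbb C^2: v=\gamma(t)\}$ is not contained in $\mathcal A$. Suppose that an analytical continuation $\omega$ of $u$ may be got along $\gamma|_{[0,1)}$. Then the limit $$\lim_{t\to1}\omega\circ\gamma(t)$$ exists within $\mathbb P^1=\mathbb C\cup\{\infty\}$.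
   Context: A Riemann domain over a region $\mathcal U\subset\mathbb C^N$ is a complex manifold $\Delta$ (of dimension $N$) together with a holomorphic surjective mapping $p:\Delta\to\mathcal U$ of everywhere maximum rank (so $p$ is a local biholomorphism); it is called proper if $p$ is a proper map. Here $N=2$ and $\mathcal U=\mathbb C^2\setminus\mathcal N$. A curve in a two-dimensional complex manifold is a closed complex-analytic subset of pure dimension $1$ (possibly empty). "$\mathcal A$ is algebraic" means that $\mathcal A$ is an algebraic curve in $\mathbb C^2$. $\mathbb D(c,\rho)$ denotes the open disc of centre $c$ and radius $\rho$ in $\mathbb C$. A local inverse of $p$ is a holomorphic map $\eta:\mathbb D_1\times\mathbb D_2\to\Delta$ with $p\circ\eta=\mathrm{id}$. Local existence and uniqueness (fixing $r$): if $G$ is holomorphic in $\mathbb D(u_0,b)\times\mathbb D(v_0,a)$ with $|G|\le M$ and $|\partial G/\partial u|\le K$ there, and $0<r<\min(a,b/M,1/K)$, then there is a unique holomorphic $u:\mathbb D(v_0,r)\to\mathbb D(u_0,b)$ with $u'(v)=G(u(v),v)$ and $u(v_0)=u_0$. This is applied to $G=F\circ\eta$ on $\mathbb D_1\times\mathbb D_2$, with $\mathbb D_1=\mathbb D(u_0,b)$, $\mathbb D_2=\mathbb D(v_0,a)$, the bidisc being taken small enough that such finite bounds $M,K$ exist. "An analytical continuation $\omega$ of $u$ may be got along $\gamma|_{[0,1)}$" means: there are a connected open set $\mathcal V\supset\gamma([0,1))$ and a holomorphic function $\omega:\mathcal V\to\mathbb C$ which coincides with $u$ in a neighbourhood of $v_0$.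 *)

theory Defs
  imports "HOL-Analysis.Analysis" "HOL-Computational_Algebra.Polynomial"
begin

text \<open>The set \<open>S\<close> is meant to be open; holomorphy is complex differentiability at every
  point, that is, real differentiability with a complex-linear derivative.\<close>

definition holomorphic2_on :: "(complex \<times> complex \<Rightarrow> complex) \<Rightarrow> (complex \<times> complex) set \<Rightarrow> bool"
  where "holomorphic2_on f S \<longleftrightarrow>
    (\<forall>z\<in>S. \<exists>a b. (f has_derivative (\<lambda>h. a * fst h + b * snd h)) (at z))"

definition holomorphic2_map_on ::
    "(complex \<times> complex \<Rightarrow> complex \<times> complex) \<Rightarrow> (complex \<times> complex) set \<Rightarrow> bool"
  where "holomorphic2_map_on f S \<longleftrightarrow>
    holomorphic2_on (\<lambda>z. fst (f z)) S \<and> holomorphic2_on (\<lambda>z. snd (f z)) S"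

type_synonym 'a chart = "'a set \<times> ('a \<Rightarrow> complex \<times> complex)"

definition is_chart :: "'a topology \<Rightarrow> 'a chart \<Rightarrow> bool"
  where "is_chart X c \<longleftrightarrow> (case c of (U, \<phi>) \<Rightarrow>
    openin X U \<and> open (\<phi> ` U) \<and>
    homeomorphic_map (subtopology X U) (top_of_set (\<phi> ` U)) \<phi>)"

definition compatible_charts :: "'a chart \<Rightarrow> 'a chart \<Rightarrow> bool"
  where "compatible_charts c d \<longleftrightarrow> (case (c, d) of ((U, \<phi>), (V, \<psi>)) \<Rightarrow>
    holomorphic2_map_on (\<psi> \<circ> inv_into U \<phi>) (\<phi> ` (U \<inter> V)) \<and>
    holomorphic2_map_on (\<phi> \<circ> inv_into V \<psi>) (\<psi> ` (U \<inter> V)))"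

text \<open>The manifold is the topological space \<open>X\<close> (with carrier \<open>topspace X\<close>) equipped with the
  holomorphic atlas \<open>\<A>\<close>; the atlas need not be maximal.\<close>

definition complex_surface :: "'a topology \<Rightarrow> 'a chart set \<Rightarrow> bool"
  where "complex_surface X \<A> \<longleftrightarrow>
    Hausdorff_space X \<and> second_countable X \<and>
    (\<forall>c\<in>\<A>. is_chart X c) \<and> (\<Union>c\<in>\<A>. fst c) = topspace X \<and>
    (\<forall>c\<in>\<A>. \<forall>d\<in>\<A>. compatible_charts c d)"

definition C2_atlas :: "(complex \<times> complex) chart set"
  where "C2_atlas = {(UNIV, id)}"

definition holomorphic_fun_on :: "'a chart set \<Rightarrow> ('a \<Rightarrow> complex) \<Rightarrow> 'a set \<Rightarrow> bool"
  where "holomorphic_fun_on \<A> f W \<longleftrightarrow>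
    (\<forall>(U, \<phi>)\<in>\<A>. holomorphic2_on (f \<circ> inv_into U \<phi>) (\<phi> ` (U \<inter> W)))"

definition holomorphic_into ::
    "(complex \<times> complex) set \<Rightarrow> 'a topology \<Rightarrow> 'a chart set \<Rightarrow> (complex \<times> complex \<Rightarrow> 'a) \<Rightarrow> bool"
  where "holomorphic_into S X \<A> \<eta> \<longleftrightarrow>
    continuous_map (top_of_set S) X \<eta> \<and>
    (\<forall>(U, \<phi>)\<in>\<A>. holomorphic2_map_on (\<phi> \<circ> \<eta>) {z \<in> S. \<eta> z \<in> U})"

text \<open>A meromorphic function is locally a quotient of holomorphic functions whose denominator
  vanishes identically on no nonempty open set. It is represented by a total function, whose
  values at points where no local representation has a nonzero denominator (in particular at
  poles and points of indeterminacy) are irrelevant.\<close>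

definition meromorphic_fun :: "'a topology \<Rightarrow> 'a chart set \<Rightarrow> ('a \<Rightarrow> complex) \<Rightarrow> bool"
  where "meromorphic_fun X \<A> F \<longleftrightarrow>
    (\<forall>x\<in>topspace X. \<exists>W g h. openin X W \<and> x \<in> W \<and>
       holomorphic_fun_on \<A> g W \<and> holomorphic_fun_on \<A> h W \<and>
       X interior_of {y \<in> W. h y = 0} = {} \<and>
       (\<forall>y\<in>W. h y \<noteq> 0 \<longrightarrow> F y = g y / h y))"

definition analytic_subset :: "'a topology \<Rightarrow> 'a chart set \<Rightarrow> 'a set \<Rightarrow> bool"
  where "analytic_subset X \<A> A \<longleftrightarrow>
    closedin X A \<and>
    (\<forall>x\<in>topspace X. \<exists>W \<F>. openin X W \<and> x \<in> W \<and> finite \<F> \<and>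
       (\<forall>f\<in>\<F>. holomorphic_fun_on \<A> f W) \<and>
       A \<inter> W = {y \<in> W. \<forall>f\<in>\<F>. f y = 0})"

text \<open>For \<open>k \<le> 2\<close>, this is the coordinate subspace of complex dimension \<open>k\<close>.\<close>

definition coord_subspace :: "nat \<Rightarrow> (complex \<times> complex) set"
  where "coord_subspace k = {z. (k < 2 \<longrightarrow> snd z = 0) \<and> (k < 1 \<longrightarrow> fst z = 0)}"

text \<open>The points of \<open>A\<close> near which \<open>A\<close> is a complex submanifold of dimension \<open>k\<close>.\<close>

definition regular_points :: "'a topology \<Rightarrow> 'a chart set \<Rightarrow> 'a set \<Rightarrow> nat \<Rightarrow> 'a set"
  where "regular_points X \<A> A k =
    {x \<in> A. k \<le> 2 \<and> (\<exists>U \<psi>. is_chart X (U, \<psi>) \<and> (\<forall>c\<in>\<A>. compatible_charts (U, \<psi>) c) \<and>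
       x \<in> U \<and> A \<inter> U = {y \<in> U. \<psi> y \<in> coord_subspace k})}"

text \<open>The dimension of an analytic set at \<open>x\<close> is the upper limit of its dimensions at the
  regular points tending to \<open>x\<close>.\<close>

definition analytic_dim_at :: "'a topology \<Rightarrow> 'a chart set \<Rightarrow> 'a set \<Rightarrow> 'a \<Rightarrow> nat"
  where "analytic_dim_at X \<A> A x = Sup {k. x \<in> X closure_of (regular_points X \<A> A k)}"

definition curve :: "'a topology \<Rightarrow> 'a chart set \<Rightarrow> 'a set \<Rightarrow> bool"
  where "curve X \<A> A \<longleftrightarrow>
    analytic_subset X \<A> A \<and> (\<forall>x\<in>A. analytic_dim_at X \<A> A x = 1)"

text \<open>Bivariate polynomials are elements of \<open>complex poly poly\<close>. Nonzero constants are
  allowed, so that the empty curve is algebraic.\<close>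

definition algebraic_curve :: "(complex \<times> complex) set \<Rightarrow> bool"
  where "algebraic_curve A \<longleftrightarrow>
    (\<exists>P :: complex poly poly. P \<noteq> 0 \<and> A = {(u, v). poly (poly P [:u:]) v = 0})"

definition riemann_domain ::
    "'a topology \<Rightarrow> 'a chart set \<Rightarrow> ('a \<Rightarrow> complex \<times> complex) \<Rightarrow> (complex \<times> complex) set \<Rightarrow> bool"
  where "riemann_domain X \<A> p \<U> \<longleftrightarrow>
    open \<U> \<and> connected \<U> \<and> complex_surface X \<A> \<and> p ` topspace X = \<U> \<and>
    holomorphic_fun_on \<A> (\<lambda>x. fst (p x)) (topspace X) \<and>
    holomorphic_fun_on \<A> (\<lambda>x. snd (p x)) (topspace X) \<and>
    (\<forall>(U, \<phi>)\<in>\<A>. \<forall>z\<in>\<phi> ` U. \<exists>D. (p \<circ> inv_into U \<phi> has_derivative D) (at z) \<and> surj D)"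

definition proper_riemann_domain ::
    "'a topology \<Rightarrow> 'a chart set \<Rightarrow> ('a \<Rightarrow> complex \<times> complex) \<Rightarrow> (complex \<times> complex) set \<Rightarrow> bool"
  where "proper_riemann_domain X \<A> p \<U> \<longleftrightarrow>
    riemann_domain X \<A> p \<U> \<and> proper_map X (top_of_set \<U>) p"

definition local_inverse ::
    "'a topology \<Rightarrow> 'a chart set \<Rightarrow> ('a \<Rightarrow> complex \<times> complex) \<Rightarrow> (complex \<times> complex) set
      \<Rightarrow> (complex \<times> complex \<Rightarrow> 'a) \<Rightarrow> bool"
  where "local_inverse X \<A> p S \<eta> \<longleftrightarrow>
    holomorphic_into S X \<A> \<eta> \<and> (\<forall>z\<in>S. p (\<eta> z) = z)"

text \<open>Unlike \<open>C1_differentiable_on {0..1}\<close>, this uses one-sided derivatives at the end points,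
  so values outside the unit interval do not matter.\<close>

definition C1_on_unit_interval :: "(real \<Rightarrow> complex) \<Rightarrow> bool"
  where "C1_on_unit_interval \<gamma> \<longleftrightarrow>
    (\<exists>D. continuous_on {0..1} D \<and>
       (\<forall>t\<in>{0..1}. (\<gamma> has_vector_derivative D t) (at t within {0..1})))"

text \<open>The topological space underlying the complex projective line; \<open>None\<close> is the point at
  infinity.\<close>

definition riemann_sphere :: "complex option topology"
  where "riemann_sphere = Alexandroff_compactification euclidean"

end

theory Submission
  imports Defs "HOL-Complex_Analysis.Complex_Analysis"
begin

text \<open>The proof follows Painleve's argument, in a form that needs no existence theorem for
  differential equations. Let \<open>A = N \<union> p(M)\<close> and, for a point \<open>z\<close> off \<open>A\<close>, let \<open>\<Phi>(z)\<close> be the finite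
  set of values of \<open>F\<close> on the fibre \<open>p\<inverse>(z)\<close>. Because \<open>p\<close> is a proper local biholomorphism, \<open>\<Phi>\<close> is
  locally given by finitely many holomorphic branches (\<open>proper_riemann_domain_branches\<close>).

  The continuation \<open>\<omega>\<close> satisfies \<open>\<omega>'(v) \<in> \<Phi>(\<omega>(v), v)\<close> wherever its graph avoids \<open>A\<close>
  (\<open>relation_off_algebraic_curve\<close>). This holds near a point where \<open>\<omega> = u\<close>, and it spreads by the
  identity theorem, applied to the product of the functions \<open>\<omega>' - G(\<omega>, v)\<close> over the branches \<open>G\<close>:
  unless the graph lies in \<open>A\<close>, it meets \<open>A\<close> only over a countable set, which does not disconnect
  the domain of \<open>\<omega>\<close>. If it lies in \<open>A\<close>, the assertion is vacuous.

  Since \<open>A\<close> is algebraic and does not contain the line \<open>v = \<gamma>(1)\<close>, only finitely many \<open>c\<close> satisfy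
  \<open>(c, \<gamma>(1)) \<in> A\<close>. Let \<open>c\<close> be a finite limit point of \<open>\<omega> \<circ> \<gamma>\<close> at the end of the arc which is not one
  of them. Near \<open>(c, \<gamma>(1))\<close> the values of \<open>\<Phi>\<close>, and hence \<open>\<omega>'\<close>, are bounded, while \<open>\<gamma>\<close> is Lipschitz;
  so, once \<open>\<omega> \<circ> \<gamma>\<close> is close to \<open>c\<close>, it cannot move away in the short time left, and it converges to \<open>c\<close>
  (\<open>cluster_point_imp_limit\<close>). If instead all finite limit points belong to a finite set, then
  there is only one limit point in the sphere, by connectedness, and it is the limit
  (\<open>riemann_sphere_limit_exists\<close>).\<close>

section \<open>Holomorphic functions of two complex variables\<close>

lemma holomorphic2_on_subset: "holomorphic2_on f S \<Longrightarrow> T \<subseteq> S \<Longrightarrow> holomorphic2_on f T"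
  by (auto simp: holomorphic2_on_def)

lemma holomorphic2_on_imp_isCont: "holomorphic2_on f S \<Longrightarrow> z \<in> S \<Longrightarrow> isCont f z"
  unfolding holomorphic2_on_def using has_derivative_continuous by blast

lemma holomorphic2_compose_curve:
  assumes "holomorphic2_on G S" "(\<omega> x, x) \<in> S" "(\<omega> has_field_derivative d) (at x)"
  shows "(\<lambda>w. G (\<omega> w, w)) field_differentiable at x"
proof -
  obtain a b where ab: "(G has_derivative (\<lambda>h. a * fst h + b * snd h)) (at (\<omega> x, x))"
    using assms(1,2) unfolding holomorphic2_on_def by blast
  have "((\<lambda>w. (\<omega> w, w)) has_derivative (\<lambda>h. (d * h, h))) (at x)"
    using assms(3) unfolding has_field_derivative_def
    by (intro has_derivative_Pair) auto
  from diff_chain_at[OF this ab] have "((\<lambda>w. G (\<omega> w, w)) has_derivative (\<lambda>h. (a * d + b) * h)) (at x)"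
    by (simp add: o_def algebra_simps)
  then show ?thesis
    unfolding field_differentiable_def has_field_derivative_def by blast
qed

text \<open>Holomorphic functions of two variables, which are only assumed differentiable, are of
  class \<open>C\<^sup>1\<close>: the directional derivatives are controlled by the Cauchy inequality, applied to
  the difference of the restrictions to two parallel complex lines.\<close>

lemma holomorphic2_continuous_partials:
  assumes hol: "holomorphic2_on f S" and S: "open S"
  obtains a b where "continuous_on S a" "continuous_on S b"
    "\<And>z. z \<in> S \<Longrightarrow> (f has_derivative (\<lambda>h. a z * fst h + b z * snd h)) (at z)"
proof -
  obtain a b where ab: "\<And>z. z \<in> S \<Longrightarrow> (f has_derivative (\<lambda>h. a z * fst h + b z * snd h)) (at z)"
    using hol unfolding holomorphic2_on_def by metis
  have cont: "continuous_on S (\<lambda>z. a z * e1 + b z * e2)" for e1 e2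
  proof (rule continuous_at_imp_continuous_on, rule ballI)
    fix z0 assume z0: "z0 \<in> S"
    \<comment> \<open>The displacement by \<open>w\<close> along the direction \<open>(e1, e2)\<close>.\<close>
    define L where "L = (\<lambda>w. (w * e1, w * e2))"
    have nL: "norm (L w) = norm w * norm (e1, e2)" for w
      by (simp add: L_def norm_Pair norm_mult power_mult_distrib real_sqrt_mult flip: distrib_left)
    obtain R where R: "R > 0" "cball z0 (2 * R) \<subseteq> S"
    proof -
      obtain R' where "R' > 0" "cball z0 R' \<subseteq> S" using S z0 open_contains_cball by blast
      then show ?thesis using that[of "R'/2"] by auto
    qed
    define \<rho> where "\<rho> = R / (norm (e1, e2) + 1)"
    have pos1: "norm (e1, e2) + 1 > 0" by (smt (verit) norm_ge_zero)
    have \<rho>: "\<rho> > 0" "\<rho> * norm (e1, e2) \<le> R"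
      using R(1) pos1 by (auto simp: \<rho>_def field_simps)
    have inS: "z + L w \<in> cball z0 (2 * R)" if "dist z z0 \<le> R" "norm w \<le> \<rho>" for z w
    proof -
      have "norm (L w) \<le> R"
        using that(2) \<rho> by (smt (verit) nL mult_right_mono norm_ge_zero)
      moreover have "dist z0 (z + L w) \<le> dist z z0 + norm (L w)"
        by (metis (no_types) dist_commute dist_triangle add_diff_cancel_left' dist_norm add.commute norm_minus_commute dist_triangle3)
      ultimately show ?thesis using that(1) by auto
    qed
    have der: "((\<lambda>w. f (z + L w)) has_field_derivative (a (z + L w) * e1 + b (z + L w) * e2)) (at w)"
      if "dist z z0 \<le> R" "norm w \<le> \<rho>" for z w
    proof -
      have "((\<lambda>w. z + L w) has_derivative (\<lambda>h. (h * e1, h * e2))) (at w)"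
        unfolding L_def by (auto intro!: derivative_eq_intros has_derivative_Pair)
      from diff_chain_at[OF this ab]
      have "((\<lambda>w. f (z + L w)) has_derivative (\<lambda>h. a (z + L w) * (h * e1) + b (z + L w) * (h * e2))) (at w)"
        using inS[OF that] R(2) by (auto simp: o_def)
      moreover have "(\<lambda>h. a (z + L w) * (h * e1) + b (z + L w) * (h * e2))
          = (*) (a (z + L w) * e1 + b (z + L w) * e2)"
        by (rule ext) (simp add: algebra_simps)
      ultimately show ?thesis
        by (simp add: has_field_derivative_def)
    qed
    have uc: "uniformly_continuous_on (cball z0 (2 * R)) f"
      using hol R(2) holomorphic2_on_imp_isCont
      by (meson compact_uniformly_continuous compact_cball continuous_at_imp_continuous_on subsetD)
    show "isCont (\<lambda>z. a z * e1 + b z * e2) z0"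
    proof (unfold continuous_at_eps_delta, intro allI impI)
      fix \<epsilon> :: real assume \<epsilon>: "\<epsilon> > 0"
      obtain \<delta> where \<delta>: "\<delta> > 0"
        "\<And>x y. x \<in> cball z0 (2 * R) \<Longrightarrow> y \<in> cball z0 (2 * R) \<Longrightarrow> dist x y < \<delta> \<Longrightarrow> dist (f x) (f y) < \<epsilon> * \<rho> / 2"
        using uc unfolding uniformly_continuous_on_def
        by (metis \<epsilon> \<rho>(1) half_gt_zero mult_pos_pos dist_commute)
      show "\<exists>d>0. \<forall>z. dist z z0 < d \<longrightarrow> dist (a z * e1 + b z * e2) (a z0 * e1 + b z0 * e2) < \<epsilon>"
      proof (intro exI[of _ "min \<delta> R"] conjI allI impI)
        fix z assume z: "dist z z0 < min \<delta> R"
        \<comment> \<open>Its derivative at \<open>0\<close> is the difference of the directional derivatives at \<open>z\<close> and \<open>z0\<close>.\<close>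
        define k where "k = (\<lambda>w. f (z + L w) - f (z0 + L w))"
        have dk: "(k has_field_derivative
            ((a (z + L w) * e1 + b (z + L w) * e2) - (a (z0 + L w) * e1 + b (z0 + L w) * e2))) (at w)"
          if "norm w \<le> \<rho>" for w
          unfolding k_def using that z R(1) by (intro DERIV_diff der) auto
        have "norm ((deriv ^^ 1) k 0) \<le> fact 1 * (\<epsilon> * \<rho> / 2) / \<rho> ^ 1"
        proof (rule Cauchy_inequality)
          show "k holomorphic_on ball 0 \<rho>"
            unfolding holomorphic_on_def field_differentiable_def
            using dk by (metis DERIV_subset dist_0_norm less_imp_le mem_ball subset_UNIV)
          show "continuous_on (cball 0 \<rho>) k"
            using dk DERIV_isCont by (metis continuous_at_imp_continuous_on dist_0_norm mem_cball)
          fix w :: complex assume w: "norm (0 - w) = \<rho>"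
          have "dist (z + L w) (z0 + L w) < \<delta>" using z by simp
          moreover have "z + L w \<in> cball z0 (2 * R)" "z0 + L w \<in> cball z0 (2 * R)"
            using inS[of z w] inS[of z0 w] w z R(1) by auto
          ultimately have "dist (f (z + L w)) (f (z0 + L w)) < \<epsilon> * \<rho> / 2"
            using \<delta>(2) by blast
          then show "norm (k w) \<le> \<epsilon> * \<rho> / 2"
            by (simp add: k_def dist_norm)
        qed (use \<rho> in auto)
        moreover have "L 0 = 0" by (simp add: L_def zero_prod_def)
        moreover have "deriv k 0 = (a (z + L 0) * e1 + b (z + L 0) * e2) - (a (z0 + L 0) * e1 + b (z0 + L 0) * e2)"
          using dk[of 0] \<rho>(1) by (intro DERIV_imp_deriv) auto
        ultimately show "dist (a z * e1 + b z * e2) (a z0 * e1 + b z0 * e2) < \<epsilon>"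
          using \<rho>(1) \<epsilon> by (simp add: dist_norm)
      qed (use \<delta> R in auto)
    qed
  qed
  show ?thesis
    using that[of a b] cont[of 1 0] cont[of 0 1] ab by simp
qed

lemma complex_linear_functional_Pair:
  fixes l :: "complex \<times> complex \<Rightarrow> complex"
  assumes "linear l" and "\<And>c h. l (c * fst h, c * snd h) = c * l h"
  shows "l = (\<lambda>h. l (1, 0) * fst h + l (0, 1) * snd h)"
proof
  fix h :: "complex \<times> complex"
  have "l h = l ((fst h, 0) + (0, snd h))" by simp
  also have "\<dots> = l (fst h, 0) + l (0, snd h)" using assms(1) linear_add by blast
  finally show "l h = l (1, 0) * fst h + l (0, 1) * snd h"
    using assms(2)[of "fst h" "(1, 0)"] assms(2)[of "snd h" "(0, 1)"] by (simp add: mult.commute)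
qed

text \<open>The inverse of the holomorphic map has complex-linear derivatives because the inverse of
  a complex-linear bijection is complex-linear.\<close>

lemma holomorphic2_inverse_function:
  assumes S: "open S" and hol: "holomorphic2_map_on f S" and z0: "z0 \<in> S"
    and D: "(f has_derivative D) (at z0)" "surj D"
  obtains U V g where "open U" "z0 \<in> U" "U \<subseteq> S" "open V" "f z0 \<in> V" "homeomorphism U V f g"
    "holomorphic2_map_on g V"
proof -
  obtain a1 b1 where 1: "continuous_on S a1" "continuous_on S b1"
    "\<And>z. z \<in> S \<Longrightarrow> ((\<lambda>z. fst (f z)) has_derivative (\<lambda>h. a1 z * fst h + b1 z * snd h)) (at z)"
    using hol S holomorphic2_continuous_partials unfolding holomorphic2_map_on_def by blast
  obtain a2 b2 where 2: "continuous_on S a2" "continuous_on S b2"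
    "\<And>z. z \<in> S \<Longrightarrow> ((\<lambda>z. snd (f z)) has_derivative (\<lambda>h. a2 z * fst h + b2 z * snd h)) (at z)"
    using hol S holomorphic2_continuous_partials unfolding holomorphic2_map_on_def by blast
  define T where "T = (\<lambda>z h. (a1 z * fst h + b1 z * snd h, a2 z * fst h + b2 z * snd h))"
  define f' where "f' = (\<lambda>z. Blinfun (T z))"
  have bl: "bounded_linear (T z)" for z
    unfolding T_def by (intro bounded_linear_intros)
  have app: "blinfun_apply (f' z) = T z" for z
    unfolding f'_def using bl by (rule bounded_linear_Blinfun_apply)
  have derf: "(f has_derivative blinfun_apply (f' z)) (at z)" if "z \<in> S" for z
    using has_derivative_Pair[OF 1(3)[OF that] 2(3)[OF that]] by (simp add: app T_def)
  have contf: "continuous_on S f'"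
  proof (rule continuous_on_blinfun_componentwise)
    fix i :: "complex \<times> complex" assume "i \<in> Basis"
    show "continuous_on S (\<lambda>x. blinfun_apply (f' x) i)"
      unfolding app T_def using 1 2 by (intro continuous_intros)
  qed
  have "D = T z0"
    using has_derivative_unique[OF D(1)] derf[OF z0] by (simp add: app)
  then have "surj (T z0)" using D(2) by simp
  then obtain h where h: "linear h" "h \<circ> T z0 = id"
    using linear_surjective_isomorphism[of "T z0"] bl bounded_linear.linear
    by (metis comp_def eq_id_iff)
  have invf: "Blinfun h o\<^sub>L f' z0 = id_blinfun"
  proof (rule blinfun_eqI)
    fix i
    have bh: "bounded_linear h" by (rule linear_conv_bounded_linear[THEN iffD1, OF h(1)])
    have "blinfun_apply (Blinfun h o\<^sub>L f' z0) i = h (T z0 i)"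
      unfolding blinfun_apply_blinfun_compose app bounded_linear_Blinfun_apply[OF bh] ..
    also have "\<dots> = i"
      using fun_cong[OF h(2), of i] unfolding o_def id_def .
    finally show "blinfun_apply (Blinfun h o\<^sub>L f' z0) i = blinfun_apply id_blinfun i"
      unfolding blinfun_apply_id_blinfun .
  qed
  obtain U V g g' where g: "open U" "U \<subseteq> S" "z0 \<in> U" "open V" "f z0 \<in> V" "homeomorphism U V f g"
    "\<And>y. y \<in> V \<Longrightarrow> (g has_derivative (g' y)) (at y)"
    "\<And>y. y \<in> V \<Longrightarrow> g' y = inv (blinfun_apply (f' (g y)))"
    "\<And>y. y \<in> V \<Longrightarrow> bij (blinfun_apply (f' (g y)))"
    using inverse_function_theorem[OF S derf contf z0 invf] by metis
  have "holomorphic2_map_on g V"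
    unfolding holomorphic2_map_on_def holomorphic2_on_def
  proof (intro conjI ballI)
    fix y assume y: "y \<in> V"
    let ?T = "T (g y)"
    have bijT: "bij ?T" and inv: "g' y = inv ?T"
      using g(8,9)[OF y] by (auto simp: app)
    have lin: "linear (g' y)"
      using g(7)[OF y] has_derivative_linear by blast
    have scal: "g' y (c * fst k, c * snd k) = (c * fst (g' y k), c * snd (g' y k))" for c k
    proof -
      have "?T (c * fst (g' y k), c * snd (g' y k)) = (c * fst (?T (g' y k)), c * snd (?T (g' y k)))"
        by (simp add: T_def algebra_simps)
      also have "?T (g' y k) = k" using bijT inv by (simp add: bij_is_surj surj_f_inv_f)
      finally show ?thesis using bijT inv by (metis bij_inv_eq_iff)
    qed
    have "((\<lambda>z. fst (g z)) has_derivative (\<lambda>h. fst (g' y h))) (at y)"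
      "((\<lambda>z. snd (g z)) has_derivative (\<lambda>h. snd (g' y h))) (at y)"
      using g(7)[OF y] by (auto intro: has_derivative_fst has_derivative_snd)
    note der = this
    have "(\<lambda>h. fst (g' y h)) = (\<lambda>h. fst (g' y (1, 0)) * fst h + fst (g' y (0, 1)) * snd h)"
      by (rule complex_linear_functional_Pair) (use der(1) has_derivative_linear in blast, simp add: scal)
    moreover have "(\<lambda>h. snd (g' y h)) = (\<lambda>h. snd (g' y (1, 0)) * fst h + snd (g' y (0, 1)) * snd h)"
      by (rule complex_linear_functional_Pair) (use der(2) has_derivative_linear in blast, simp add: scal)
    ultimately show "\<exists>a b. ((\<lambda>z. fst (g z)) has_derivative (\<lambda>h. a * fst h + b * snd h)) (at y)"
      "\<exists>a b. ((\<lambda>z. snd (g z)) has_derivative (\<lambda>h. a * fst h + b * snd h)) (at y)"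
      using der by (auto intro!: exI)
  qed
  then show ?thesis using that g by blast
qed

lemma holomorphic2_on_compose:
  assumes "holomorphic2_map_on g V" "holomorphic2_on G S" "g ` V \<subseteq> S"
  shows "holomorphic2_on (G \<circ> g) V"
  unfolding holomorphic2_on_def
proof
  fix z assume z: "z \<in> V"
  obtain a b where ab: "(G has_derivative (\<lambda>h. a * fst h + b * snd h)) (at (g z))"
    using assms z unfolding holomorphic2_on_def by blast
  obtain a1 b1 a2 b2 where
    "((\<lambda>z. fst (g z)) has_derivative (\<lambda>h. a1 * fst h + b1 * snd h)) (at z)"
    "((\<lambda>z. snd (g z)) has_derivative (\<lambda>h. a2 * fst h + b2 * snd h)) (at z)"
    using assms(1) z unfolding holomorphic2_map_on_def holomorphic2_on_def by blast
  from has_derivative_Pair[OF this]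
  have "(g has_derivative (\<lambda>h. (a1 * fst h + b1 * snd h, a2 * fst h + b2 * snd h))) (at z)"
    by simp
  from diff_chain_at[OF this ab]
  have "(G \<circ> g has_derivative (\<lambda>h. (a * a1 + b * a2) * fst h + (a * b1 + b * b2) * snd h)) (at z)"
    by (simp add: o_def algebra_simps)
  then show "\<exists>a b. (G \<circ> g has_derivative (\<lambda>h. a * fst h + b * snd h)) (at z)" by blast
qed

section \<open>Branches of a function on a proper Riemann domain\<close>

text \<open>Near a point of an open set \<open>T\<close> on which \<open>F\<close> is holomorphic, the projection is a bijection
  of an open set \<open>W\<close> onto an open set \<open>B\<close> with inverse \<open>\<eta>\<close>, and \<open>F\<close> becomes a holomorphic function
  on \<open>B\<close>.\<close>

lemma riemann_domain_local_section:
  assumes rd: "riemann_domain X \<A> p \<U>" and T: "openin X T"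
    and F: "holomorphic_fun_on \<A> F T" and x: "x \<in> T"
  obtains B W \<eta> where "open B" "p x \<in> B" "openin X W" "x \<in> W"
    "\<And>z. z \<in> B \<Longrightarrow> \<eta> z \<in> W \<and> p (\<eta> z) = z" "\<And>y. y \<in> W \<Longrightarrow> p y \<in> B \<and> \<eta> (p y) = y"
    "holomorphic2_on (F \<circ> \<eta>) B"
proof -
  have xX: "x \<in> topspace X" using T x openin_subset by blast
  moreover have "(\<Union>c\<in>\<A>. fst c) = topspace X"
    using rd unfolding riemann_domain_def complex_surface_def by blast
  ultimately have "\<exists>c\<in>\<A>. x \<in> fst c" by blast
  then obtain U \<phi> where c: "(U, \<phi>) \<in> \<A>" "x \<in> U"
    by (metis prod.collapse)
  then have "is_chart X (U, \<phi>)"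
    using rd unfolding riemann_domain_def complex_surface_def by blast
  then have U: "openin X U" and opU: "open (\<phi> ` U)"
    and hom: "homeomorphic_map (subtopology X U) (top_of_set (\<phi> ` U)) \<phi>"
    unfolding is_chart_def by auto
  have UX: "U \<subseteq> topspace X" using U openin_subset by blast
  then have tU: "topspace (subtopology X U) = U" by auto
  have inj: "inj_on \<phi> U" using homeomorphic_imp_injective_map[OF hom] tU by simp
  define \<psi> where "\<psi> = inv_into U \<phi>"
  have \<psi>\<phi>: "\<psi> (\<phi> y) = y" if "y \<in> U" for y using inj that by (simp add: \<psi>_def)
  define S where "S = \<phi> ` (U \<inter> T)"
  have "openin (subtopology X U) (U \<inter> T)"
    using T by (simp add: openin_subtopology_Int2)
  then have "openin (top_of_set (\<phi> ` U)) S"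
    using homeomorphic_imp_open_map[OF hom] unfolding open_map_def S_def by blast
  then have opS: "open S" using opU openin_open_eq by blast
  have SU: "S \<subseteq> \<phi> ` U" by (auto simp: S_def)
  have UT: "U \<inter> topspace X = U" using UX by blast
  have "holomorphic2_on ((\<lambda>x. fst (p x)) \<circ> \<psi>) (\<phi> ` U)" "holomorphic2_on ((\<lambda>x. snd (p x)) \<circ> \<psi>) (\<phi> ` U)"
    using rd c(1) UT unfolding riemann_domain_def holomorphic_fun_on_def \<psi>_def by fastforce+
  then have hp: "holomorphic2_map_on (p \<circ> \<psi>) S"
    using SU holomorphic2_on_subset unfolding holomorphic2_map_on_def o_def by blast
  obtain D where D: "(p \<circ> \<psi> has_derivative D) (at (\<phi> x))" "surj D"
    using rd c unfolding riemann_domain_def \<psi>_def by fast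
  have "\<phi> x \<in> S" using c x by (auto simp: S_def)
  from holomorphic2_inverse_function[OF opS hp this D]
  obtain U' V g where g: "open U'" "\<phi> x \<in> U'" "U' \<subseteq> S" "open V" "(p \<circ> \<psi>) (\<phi> x) \<in> V"
    "homeomorphism U' V (p \<circ> \<psi>) g" "holomorphic2_map_on g V"
    by metis
  define W where "W = {y \<in> U. \<phi> y \<in> U'}"
  have "openin (subtopology X U) {y \<in> topspace (subtopology X U). \<phi> y \<in> U' \<inter> \<phi> ` U}"
    using homeomorphic_imp_continuous_map[OF hom]
    by (rule openin_continuous_map_preimage) (use g(1) in \<open>auto simp: openin_open\<close>)
  moreover have "{y \<in> topspace (subtopology X U). \<phi> y \<in> U' \<inter> \<phi> ` U} = W"
    using UX by (auto simp: W_def)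
  ultimately have "openin X W" using U openin_trans_full by metis
  moreover have "\<psi> (g z) \<in> W \<and> p (\<psi> (g z)) = z" if "z \<in> V" for z
  proof -
    have "g z \<in> U'" "(p \<circ> \<psi>) (g z) = z" using g(6) that unfolding homeomorphism_def by auto
    then show ?thesis using g(3) \<psi>\<phi> unfolding W_def S_def by fastforce
  qed
  moreover have "p y \<in> V \<and> \<psi> (g (p y)) = y" if "y \<in> W" for y
  proof -
    have y: "y \<in> U" "\<phi> y \<in> U'" using that by (auto simp: W_def)
    then have "(p \<circ> \<psi>) (\<phi> y) = p y" using \<psi>\<phi> by simp
    then show ?thesis using g(6) y \<psi>\<phi> unfolding homeomorphism_def by (metis imageI)
  qed
  moreover have "holomorphic2_on (F \<circ> (\<psi> \<circ> g)) V"
  proof -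
    have "holomorphic2_on (F \<circ> \<psi>) S"
      using F c(1) unfolding holomorphic_fun_on_def \<psi>_def S_def by blast
    moreover have "g ` V \<subseteq> S" using g(3,6) unfolding homeomorphism_def by auto
    ultimately show ?thesis using holomorphic2_on_compose[OF g(7)] by (simp add: o_assoc)
  qed
  ultimately show ?thesis
    using that[of V W "\<psi> \<circ> g"] g(2,4,5) c(2) \<psi>\<phi> by (auto simp: W_def)
qed

text \<open>The multivalued function \<open>z \<mapsto> F (p\<inverse> z)\<close> has, near a point whose fibre lies in an open set
  on which \<open>F\<close> is holomorphic, finitely many holomorphic branches. The fibre is covered by finitely
  many domains of local sections because it is compact, and these domains contain the nearby
  fibres because \<open>p\<close> is closed.\<close>

lemma proper_riemann_domain_branches:
  assumes prd: "proper_riemann_domain X \<A> p \<U>" and T: "openin X T"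
    and F: "holomorphic_fun_on \<A> F T" and y: "y \<in> \<U>" and fib: "{x \<in> topspace X. p x = y} \<subseteq> T"
  obtains B \<G> where "open B" "y \<in> B" "finite \<G>" "\<And>G. G \<in> \<G> \<Longrightarrow> holomorphic2_on G B"
    "\<And>z. z \<in> B \<Longrightarrow> F ` {x \<in> topspace X. p x = z} = (\<lambda>G. G z) ` \<G>"
proof -
  have rd: "riemann_domain X \<A> p \<U>" and pm: "proper_map X (top_of_set \<U>) p"
    using prd unfolding proper_riemann_domain_def by auto
  have opU: "open \<U>" and pX: "p ` topspace X = \<U>"
    using rd unfolding riemann_domain_def by auto
  define K where "K = {x \<in> topspace X. p x = y}"
  have K: "compactin X K" using pm y unfolding proper_map_def K_def by simp
  define P where "P = (\<lambda>x B W \<eta>. open B \<and> p x \<in> B \<and> openin X W \<and> x \<in> W \<and>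
    (\<forall>z\<in>B. \<eta> z \<in> W \<and> p (\<eta> z) = z) \<and> (\<forall>y\<in>W. p y \<in> B \<and> \<eta> (p y) = y) \<and>
    holomorphic2_on (F \<circ> \<eta>) B)"
  have "\<exists>B W \<eta>. P x B W \<eta>" if "x \<in> K" for x
  proof -
    have "x \<in> T" using that fib unfolding K_def by blast
    from riemann_domain_local_section[OF rd T F this]
    obtain B W \<eta> where "open B" "p x \<in> B" "openin X W" "x \<in> W"
      "\<And>z. z \<in> B \<Longrightarrow> \<eta> z \<in> W \<and> p (\<eta> z) = z" "\<And>y. y \<in> W \<Longrightarrow> p y \<in> B \<and> \<eta> (p y) = y"
      "holomorphic2_on (F \<circ> \<eta>) B" by blast
    then have "P x B W \<eta>" by (simp add: P_def)
    then show ?thesis by blast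
  qed
  then obtain B W \<eta> where P: "\<And>x. x \<in> K \<Longrightarrow> P x (B x) (W x) (\<eta> x)"
    by metis
  have s: "open (B x)" "p x \<in> B x" "openin X (W x)" "x \<in> W x"
      "z \<in> B x \<Longrightarrow> \<eta> x z \<in> W x \<and> p (\<eta> x z) = z"
      "y \<in> W x \<Longrightarrow> p y \<in> B x \<and> \<eta> x (p y) = y"
      "holomorphic2_on (F \<circ> \<eta> x) (B x)" if "x \<in> K" for x y z
    using P[OF that] unfolding P_def by blast+
  obtain \<F> where \<F>: "finite \<F>" "\<F> \<subseteq> W ` K" "K \<subseteq> \<Union>\<F>"
  proof -
    have "Ball (W ` K) (openin X)" "K \<subseteq> \<Union>(W ` K)" using s(3,4) by auto
    then show ?thesis using K that unfolding compactin_def by (metis)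
  qed
  then obtain J where J: "finite J" "J \<subseteq> K" "K \<subseteq> (\<Union>x\<in>J. W x)"
    by (metis finite_subset_image)
  \<comment> \<open>Fibres over points outside \<open>p ` C\<close> are covered by the domains \<open>W x\<close> with \<open>x \<in> J\<close>.\<close>
  define C where "C = topspace X - (\<Union>x\<in>J. W x)"
  have "closedin X C" using s(3) J(2) unfolding C_def
    by (intro closedin_diff openin_Union) auto
  then have "closedin (top_of_set \<U>) (p ` C)"
    using pm unfolding proper_map_def closed_map_def by blast
  then have "openin (top_of_set \<U>) (\<U> - p ` C)"
    by (metis openin_diff openin_topspace topspace_euclidean_subtopology)
  then have op: "open (\<U> - p ` C)" using opU openin_open_eq by blast
  have yC: "y \<notin> p ` C" using J(3) by (auto simp: C_def K_def)
  define B' where "B' = (\<U> - p ` C) \<inter> (\<Inter>x\<in>J. B x)"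
  have B'B: "B' \<subseteq> B x" if "x \<in> J" for x using that by (auto simp: B'_def)
  show ?thesis
  proof
    show "open B'" unfolding B'_def using op s(1) J by (intro open_Int open_INT) auto
    show "y \<in> B'" using y yC s(2) J(2) by (auto simp: B'_def K_def)
    show "finite ((\<lambda>x. F \<circ> \<eta> x) ` J)" using J(1) by simp
    show "holomorphic2_on G B'" if G: "G \<in> (\<lambda>x. F \<circ> \<eta> x) ` J" for G
    proof -
      obtain x where x: "x \<in> J" "G = F \<circ> \<eta> x" using G by auto
      then show ?thesis using holomorphic2_on_subset[OF s(7) B'B[OF x(1)]] J(2) by auto
    qed
    fix z assume z: "z \<in> B'"
    show "F ` {x \<in> topspace X. p x = z} = (\<lambda>G. G z) ` (\<lambda>x. F \<circ> \<eta> x) ` J"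
    proof (intro equalityI subsetI)
      fix w assume "w \<in> F ` {x \<in> topspace X. p x = z}"
      then obtain x where x: "x \<in> topspace X" "p x = z" "w = F x" by auto
      then have "x \<notin> C" using z by (auto simp: B'_def)
      then obtain j where j: "j \<in> J" "x \<in> W j" using x by (auto simp: C_def)
      then have "\<eta> j z = x" using s(6) J(2) x by blast
      then show "w \<in> (\<lambda>G. G z) ` (\<lambda>x. F \<circ> \<eta> x) ` J" using x j by (auto simp: image_iff)
    next
      fix w assume "w \<in> (\<lambda>G. G z) ` (\<lambda>x. F \<circ> \<eta> x) ` J"
      then obtain j where j: "j \<in> J" "w = F (\<eta> j z)" by auto
      then have "\<eta> j z \<in> W j" "p (\<eta> j z) = z" using s(5) J(2) B'B z by blast+
      moreover have "W j \<subseteq> topspace X" using s(3) j J(2) openin_subset by blast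
      ultimately show "w \<in> F ` {x \<in> topspace X. p x = z}" using j by auto
    qed
  qed
qed

section \<open>Differential relations with finitely many branches\<close>

text \<open>A multivalued function, given by its sets of values, that is described near every point of
  \<open>\<Omega>\<close> by finitely many holomorphic branches. The branches need not have distinct values.\<close>

definition finitely_branched ::
    "(complex \<times> complex \<Rightarrow> complex set) \<Rightarrow> (complex \<times> complex) set \<Rightarrow> bool"
  where "finitely_branched \<Phi> \<Omega> \<longleftrightarrow>
    (\<forall>y\<in>\<Omega>. \<exists>B \<G>. open B \<and> y \<in> B \<and> finite \<G> \<and> (\<forall>G\<in>\<G>. holomorphic2_on G B) \<and>
      (\<forall>z\<in>B. \<Phi> z = (\<lambda>G. G z) ` \<G>))"

lemma finitely_branchedE:
  assumes "finitely_branched \<Phi> \<Omega>" "y \<in> \<Omega>"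
  obtains B \<G> where "open B" "y \<in> B" "finite \<G>" "\<And>G. G \<in> \<G> \<Longrightarrow> holomorphic2_on G B"
    "\<And>z. z \<in> B \<Longrightarrow> \<Phi> z = (\<lambda>G. G z) ` \<G>"
  using assms unfolding finitely_branched_def by meson

text \<open>The differential relation \<open>\<omega>' \<in> \<Phi>(\<omega>, v)\<close> means locally that the product of the functions
  \<open>\<omega>' - G(\<omega>, v)\<close>, where \<open>G\<close> runs through the branches of \<open>\<Phi>\<close>, vanishes. By the identity theorem
  it spreads over connected sets.\<close>

lemma finitely_branched_relation_continuation:
  assumes br: "finitely_branched \<Phi> \<Omega>" and W: "open W" "connected W" and \<omega>: "\<omega> holomorphic_on W"
    and graph: "\<And>v. v \<in> W \<Longrightarrow> (\<omega> v, v) \<in> \<Omega>"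
    and U: "open U" "U \<noteq> {}" "U \<subseteq> W" "\<And>v. v \<in> U \<Longrightarrow> deriv \<omega> v \<in> \<Phi> (\<omega> v, v)"
    and v: "v \<in> W"
  shows "deriv \<omega> v \<in> \<Phi> (\<omega> v, v)"
proof -
  define S where "S = interior {v \<in> W. deriv \<omega> v \<in> \<Phi> (\<omega> v, v)}"
  have SW: "S \<subseteq> W" using interior_subset unfolding S_def by blast
  have S: "deriv \<omega> v \<in> \<Phi> (\<omega> v, v)" if "v \<in> S" for v
    using that interior_subset unfolding S_def by blast
  have closed: "x \<in> S" if x: "x \<in> W" "x \<in> closure S" for x
  proof -
    obtain B \<G> where B: "open B" "(\<omega> x, x) \<in> B" "finite \<G>" "\<And>G. G \<in> \<G> \<Longrightarrow> holomorphic2_on G B"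
      "\<And>z. z \<in> B \<Longrightarrow> \<Phi> z = (\<lambda>G. G z) ` \<G>"
      using finitely_branchedE[OF br graph[OF x(1)]] by metis
    have "continuous_on W (\<lambda>w. (\<omega> w, w))"
      using holomorphic_on_imp_continuous_on[OF \<omega>] by (intro continuous_intros)
    then have "open {w \<in> W. (\<omega> w, w) \<in> B}"
      using continuous_open_preimage[OF _ W(1) B(1)] by (simp add: vimage_def Int_def)
    then obtain e where e: "e > 0" "ball x e \<subseteq> {w \<in> W. (\<omega> w, w) \<in> B}"
      using x(1) B(2) open_contains_ball by blast
    \<comment> \<open>The zeros of \<open>h\<close> are the points at which the relation holds.\<close>
    define h where "h = (\<lambda>w. \<Prod>G\<in>\<G>. (deriv \<omega> w - G (\<omega> w, w)))"
    have h0: "h w = 0 \<longleftrightarrow> deriv \<omega> w \<in> \<Phi> (\<omega> w, w)" if "w \<in> ball x e" for w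
    proof -
      have "(\<omega> w, w) \<in> B" using e that by blast
      from B(5)[OF this] show ?thesis using B(3) by (auto simp: h_def prod_zero_iff)
    qed
    have eW: "ball x e \<subseteq> W" using e by blast
    have holG: "(\<lambda>w. G (\<omega> w, w)) holomorphic_on ball x e" if "G \<in> \<G>" for G
      unfolding holomorphic_on_def
    proof
      fix w assume w: "w \<in> ball x e"
      then have "(\<omega> has_field_derivative deriv \<omega> w) (at w)"
        using holomorphic_derivI[OF \<omega> W(1)] eW by blast
      from holomorphic2_compose_curve[OF B(4)[OF that] _ this]
      have "(\<lambda>w. G (\<omega> w, w)) field_differentiable at w" using w e by blast
      then show "(\<lambda>w. G (\<omega> w, w)) field_differentiable at w within ball x e"
        by (rule field_differentiable_at_within)
    qed
    have hol: "h holomorphic_on ball x e"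
      unfolding h_def using holG holomorphic_deriv[OF \<omega> W(1)] eW
      by (intro holomorphic_on_prod holomorphic_on_diff) (auto intro: holomorphic_on_subset)
    have "h w = 0" if "w \<in> ball x e" for w
    proof (rule analytic_continuation_open[where f = h and s = "S \<inter> ball x e" and s' = "ball x e" and g = "\<lambda>_. 0"])
      show "S \<inter> ball x e \<noteq> {}"
      proof -
        obtain y where "y \<in> S" "dist y x < e" using x(2) e(1) unfolding closure_approachable by blast
        then have "y \<in> S \<inter> ball x e" by (simp add: dist_commute)
        then show ?thesis by blast
      qed
      show "h z = 0" if "z \<in> S \<inter> ball x e" for z using that S h0 by blast
    qed (use hol that in \<open>auto simp: S_def\<close>)
    then have "ball x e \<subseteq> {v \<in> W. deriv \<omega> v \<in> \<Phi> (\<omega> v, v)}" using h0 eW by blast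
    then show "x \<in> S" unfolding S_def using e(1) by (meson centre_in_ball interiorI open_ball)
  qed
  have "openin (top_of_set W) S" using SW by (simp add: S_def open_openin_trans W(1))
  moreover have "closedin (top_of_set W) S"
  proof -
    have "S = W \<inter> closure S" using SW closed closure_subset by blast
    then show ?thesis by (metis closed_closure closedin_closed)
  qed
  moreover have "U \<subseteq> S" unfolding S_def using U by (intro interior_maximal) auto
  ultimately have "S = W" using W(2) U(2) unfolding connected_clopen by blast
  then show ?thesis using S v by blast
qed

section \<open>Finite limit points at the end of the arc\<close>

lemma vector_derivative_bound_interval:
  fixes f :: "real \<Rightarrow> 'b::real_normed_vector"
  assumes "\<And>x. x \<in> {a..b} \<Longrightarrow> (f has_vector_derivative f' x) (at x within {a..b})"
    and "\<And>x. x \<in> {a..b} \<Longrightarrow> norm (f' x) \<le> B" and "a \<le> b"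
  shows "norm (f b - f a) \<le> B * (b - a)"
proof -
  have "B \<ge> 0" using assms(2)[of a] assms(3) by (smt (verit) atLeastAtMost_iff norm_ge_zero)
  have "norm (f b - f a) \<le> B * norm (b - a)"
  proof (rule differentiable_bound)
    show "(f has_derivative (\<lambda>h. h *\<^sub>R f' x)) (at x within {a..b})" if "x \<in> {a..b}" for x
      using assms(1)[OF that] by (simp add: has_vector_derivative_def)
    show "onorm (\<lambda>h. h *\<^sub>R f' x) \<le> B" if "x \<in> {a..b}" for x
      using \<open>B \<ge> 0\<close> assms(2)[OF that]
      by (intro onorm_bound) (auto simp: mult.commute[of B] intro!: mult_left_mono)
  qed (use assms in auto)
  then show ?thesis using assms(3) by simp
qed

text \<open>The point \<open>c\<close> is a limit point of \<open>f t\<close> as \<open>t\<close> increases to 1.\<close>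

definition cluster_at_left_1 :: "(real \<Rightarrow> complex) \<Rightarrow> complex \<Rightarrow> bool"
  where "cluster_at_left_1 f c \<longleftrightarrow> (\<forall>\<epsilon>>0. \<exists>\<^sub>F t in at_left 1. dist (f t) c < \<epsilon>)"

text \<open>A real-variable form of the extension of solutions: near a point at which \<open>\<Phi>\<close> is finitely
  branched the derivative of \<open>\<omega>\<close> is bounded, so that, once close to a limit point \<open>c\<close>, the
  function \<open>\<omega> \<circ> \<gamma>\<close> cannot move away from it during the short time left. The hypothesis \<open>rel\<close> is
  only needed over \<open>\<Omega>\<close>, so that the graph of \<open>\<omega>\<close> may leave \<open>\<Omega>\<close> elsewhere.\<close>

lemma cluster_point_imp_limit:
  assumes br: "finitely_branched \<Phi> \<Omega>" and \<Omega>: "open \<Omega>" "(c, \<gamma> 1) \<in> \<Omega>"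
    and V: "open V" "\<gamma> ` {0..<1} \<subseteq> V" and \<omega>: "\<omega> holomorphic_on V"
    and rel: "\<And>v. v \<in> V \<Longrightarrow> (\<omega> v, v) \<in> \<Omega> \<Longrightarrow> deriv \<omega> v \<in> \<Phi> (\<omega> v, v)"
    and \<gamma>: "C1_on_unit_interval \<gamma>"
    and cl: "cluster_at_left_1 (\<lambda>t. \<omega> (\<gamma> t)) c"
  shows "((\<lambda>t. \<omega> (\<gamma> t)) \<longlongrightarrow> c) (at_left 1)"
proof -
  obtain B \<G> where B: "open B" "(c, \<gamma> 1) \<in> B" "finite \<G>" "\<And>G. G \<in> \<G> \<Longrightarrow> holomorphic2_on G B"
    "\<And>z. z \<in> B \<Longrightarrow> \<Phi> z = (\<lambda>G. G z) ` \<G>"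
    using finitely_branchedE[OF br \<Omega>(2)] by metis
  define C where "C = 1 + (\<Sum>G\<in>\<G>. norm (G (c, \<gamma> 1)))"
  have C: "C > 0" by (simp add: C_def add_pos_nonneg sum_nonneg)
  have "\<forall>\<^sub>F z in nhds (c, \<gamma> 1). norm (G z) < C" if G: "G \<in> \<G>" for G
  proof -
    have "isCont G (c, \<gamma> 1)" using holomorphic2_on_imp_isCont[OF B(4)[OF G] B(2)] .
    then have "((\<lambda>z. norm (G z)) \<longlongrightarrow> norm (G (c, \<gamma> 1))) (nhds (c, \<gamma> 1))"
      by (intro tendsto_norm) (simp add: isCont_def tendsto_at_iff_tendsto_nhds)
    moreover have "norm (G (c, \<gamma> 1)) < C"
      using member_le_sum[OF G, of "\<lambda>G. norm (G (c, \<gamma> 1))"] B(3) by (simp add: C_def)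
    ultimately show ?thesis by (rule order_tendstoD)
  qed
  then have "\<forall>\<^sub>F z in nhds (c, \<gamma> 1). \<forall>G\<in>\<G>. norm (G z) < C"
    using B(3) by (intro eventually_ball_finite) auto
  moreover have "\<forall>\<^sub>F z in nhds (c, \<gamma> 1). z \<in> B \<inter> \<Omega>"
    using B \<Omega> by (intro eventually_nhds_in_open) auto
  ultimately have "\<forall>\<^sub>F z in nhds (c, \<gamma> 1). z \<in> B \<inter> \<Omega> \<and> (\<forall>G\<in>\<G>. norm (G z) < C)"
    by eventually_elim auto
  then obtain e where e: "e > 0"
    "\<And>z. dist z (c, \<gamma> 1) < e \<Longrightarrow> z \<in> B \<inter> \<Omega> \<and> (\<forall>G\<in>\<G>. norm (G z) < C)"
    unfolding eventually_nhds_metric by blast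
  have bound: "norm (deriv \<omega> v) \<le> C" if "v \<in> V" "dist (\<omega> v) c \<le> e / 3" "dist v (\<gamma> 1) \<le> e / 3" for v
  proof -
    have "dist (\<omega> v, v) (c, \<gamma> 1) \<le> dist (\<omega> v) c + dist v (\<gamma> 1)"
      unfolding dist_Pair_Pair by (intro sqrt_sum_squares_le_sum) auto
    also have "\<dots> < e" using that(2,3) e(1) by simp
    finally have z: "(\<omega> v, v) \<in> B" "(\<omega> v, v) \<in> \<Omega>" "\<forall>G\<in>\<G>. norm (G (\<omega> v, v)) < C"
      using e(2) by blast+
    then show ?thesis using rel[OF that(1) z(2)] B(5)[OF z(1)] by (auto intro: less_imp_le)
  qed
  obtain D where D: "continuous_on {0..1} D"
    "\<And>t. t \<in> {0..1} \<Longrightarrow> (\<gamma> has_vector_derivative D t) (at t within {0..1})"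
    using \<gamma> unfolding C1_on_unit_interval_def by blast
  have "bounded (D ` {0..1})" using D(1) compact_continuous_image compact_imp_bounded compact_Icc by blast
  then obtain L where L: "L > 0" "\<And>t. t \<in> {0..1} \<Longrightarrow> norm (D t) \<le> L"
    unfolding bounded_pos by auto
  have Lip: "dist (\<gamma> t) (\<gamma> 1) \<le> L * (1 - t)" if "t \<in> {0..1}" for t
  proof -
    have "norm (\<gamma> 1 - \<gamma> t) \<le> L * (1 - t)"
    proof (rule vector_derivative_bound_interval)
      show "(\<gamma> has_vector_derivative D x) (at x within {t..1})" if "x \<in> {t..1}" for x
        using D(2)[of x] \<open>t \<in> {0..1}\<close> that by (auto intro: has_vector_derivative_within_subset)
    qed (use L that in auto)
    then show ?thesis by (simp add: dist_norm norm_minus_commute)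
  qed
  let ?f = "\<lambda>t. \<omega> (\<gamma> t)"
  have df: "(?f has_vector_derivative (D x * deriv \<omega> (\<gamma> x))) (at x within {s..t})"
    if "0 \<le> s" "t < 1" "x \<in> {s..t}" for s t x
  proof -
    have "(\<gamma> has_vector_derivative D x) (at x within {s..t})"
      using D(2)[of x] that by (auto intro: has_vector_derivative_within_subset)
    moreover have "\<gamma> x \<in> V" using V(2) that by (auto simp: image_subset_iff)
    then have "(\<omega> has_field_derivative deriv \<omega> (\<gamma> x)) (at (\<gamma> x) within \<gamma> ` {s..t})"
      using holomorphic_derivI[OF \<omega> V(1)] has_field_derivative_at_within by blast
    ultimately show ?thesis
      using field_vector_diff_chain_within by (fastforce simp: o_def)
  qed
  have contf: "continuous_on {s..t} ?f" if "0 \<le> s" "t < 1" for s t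
    using df[OF that] by (meson continuous_on_eq_continuous_within has_vector_derivative_continuous)
  show ?thesis
  proof (rule tendstoI)
    fix \<epsilon> :: real assume "\<epsilon> > 0"
    define \<epsilon>' where "\<epsilon>' = min \<epsilon> (e / 3)"
    have \<epsilon>': "\<epsilon>' > 0" "\<epsilon>' \<le> \<epsilon>" "\<epsilon>' \<le> e / 3" using \<open>\<epsilon> > 0\<close> e(1) by (auto simp: \<epsilon>'_def)
    \<comment> \<open>The speed of \<open>\<omega> \<circ> \<gamma>\<close> is at most \<open>C * L\<close> as long as the graph is close to \<open>(c, \<gamma> 1)\<close>, so that
      it moves by at most \<open>\<epsilon>' / 2\<close> during a time \<open>\<delta>\<close>.\<close>
    define \<delta> where "\<delta> = min 1 (min (e / (3 * L)) (\<epsilon>' / (2 * C * L)))"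
    have \<delta>: "\<delta> > 0" "\<delta> \<le> 1" "L * \<delta> \<le> e / 3" "C * L * \<delta> \<le> \<epsilon>' / 2"
    proof -
      show "\<delta> > 0" "\<delta> \<le> 1" using e(1) L(1) C \<epsilon>' by (auto simp: \<delta>_def)
      have "\<delta> \<le> e / (3 * L)" "\<delta> \<le> \<epsilon>' / (2 * C * L)" by (auto simp: \<delta>_def)
      then show "L * \<delta> \<le> e / 3" "C * L * \<delta> \<le> \<epsilon>' / 2" using L(1) C by (auto simp: field_simps)
    qed
    have "\<exists>\<^sub>F t in at_left 1. dist (?f t) c < \<epsilon>' / 2"
      using cl \<epsilon>'(1) unfolding cluster_at_left_1_def by (meson half_gt_zero)
    moreover have "\<forall>\<^sub>F t in at_left (1::real). 1 - \<delta> < t \<and> t < 1"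
      using \<delta>(1) by (intro eventually_at_leftI[of "1 - \<delta>"]) auto
    ultimately have "\<exists>\<^sub>F t in at_left 1. dist (?f t) c < \<epsilon>' / 2 \<and> 1 - \<delta> < t \<and> t < 1"
      by (rule frequently_eventually_frequently)
    then obtain t where t: "dist (?f t) c < \<epsilon>' / 2" "1 - \<delta> < t" "t < 1"
      using frequently_ex by blast
    have t0: "0 \<le> t" using t(2) \<delta>(2) by simp
    have "dist (?f s) c < \<epsilon>'" if s: "t < s" "s < 1" for s
    proof (rule ccontr)
      assume far: "\<not> dist (?f s) c < \<epsilon>'"
      \<comment> \<open>The least element of \<open>E\<close> is the first time at which the distance to \<open>c\<close> reaches \<open>\<epsilon>'\<close>.\<close>
      define E where "E = {x \<in> {t..s}. dist (?f x) c = \<epsilon>'}"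
      have cd: "continuous_on {t..x} (\<lambda>x. dist (?f x) c)" if "x \<le> s" for x
        using contf[OF t0, of x] that s by (intro continuous_intros) auto
      have hit: "\<exists>y. t \<le> y \<and> y \<le> x \<and> dist (?f y) c = \<epsilon>'"
        if "x \<in> {t..s}" "\<epsilon>' \<le> dist (?f x) c" for x
        using IVT'[of "\<lambda>x. dist (?f x) c" t \<epsilon>' x] cd[of x] that t(1) \<epsilon>'(1) by auto
      have "E \<noteq> {}" using hit[of s] far s by (auto simp: E_def)
      moreover have "compact E"
      proof -
        have "closed E" unfolding E_def using cd[of s] by (intro continuous_closed_preimage_constant) auto
        then have "compact ({t..s} \<inter> E)" by (intro compact_Int_closed) auto
        moreover have "{t..s} \<inter> E = E" by (auto simp: E_def)
        ultimately show ?thesis by simp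
      qed
      ultimately obtain x where x: "x \<in> E" "\<And>y. y \<in> E \<Longrightarrow> x \<le> y"
        using compact_attains_inf[of E] by metis
      have le: "dist (?f y) c \<le> \<epsilon>'" if y: "y \<in> {t..x}" for y
      proof (rule ccontr)
        assume gt: "\<not> dist (?f y) c \<le> \<epsilon>'"
        have "x \<le> s" using x(1) by (simp add: E_def)
        then obtain z where z: "t \<le> z" "z \<le> y" "dist (?f z) c = \<epsilon>'"
          using hit[of y] y gt by auto
        then have "z \<in> E" using y \<open>x \<le> s\<close> by (simp add: E_def)
        then have "x \<le> z" by (rule x(2))
        then have "y = z" using z(2) y by simp
        then show False using z(3) gt by simp
      qed
      have xs: "t \<le> x" "x \<le> s" "dist (?f x) c = \<epsilon>'" using x(1) by (auto simp: E_def)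
      have "norm (?f x - ?f t) \<le> (L * C) * (x - t)"
      proof (rule vector_derivative_bound_interval)
        fix y assume y: "y \<in> {t..x}"
        show "(?f has_vector_derivative (D y * deriv \<omega> (\<gamma> y))) (at y within {t..x})"
          using df[OF t0 _ y] xs s by simp
        have y1: "y \<in> {0..1}" "y < 1" using y xs s t0 by auto
        have "dist (\<gamma> y) (\<gamma> 1) \<le> L * (1 - y)" using Lip y1 by blast
        also have "\<dots> \<le> L * \<delta>" using L(1) y t(2) by simp
        finally have "dist (\<gamma> y) (\<gamma> 1) \<le> e / 3" using \<delta>(3) by simp
        moreover have "\<gamma> y \<in> V" using V(2) y1 by auto
        moreover have "dist (?f y) c \<le> e / 3" using le[OF y] \<epsilon>'(3) by simp
        ultimately have "norm (deriv \<omega> (\<gamma> y)) \<le> C" using bound by blast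
        then show "norm (D y * deriv \<omega> (\<gamma> y)) \<le> L * C"
          using L(2)[OF y1(1)] L(1) by (simp add: norm_mult mult_mono)
      qed (use xs in auto)
      also have "\<dots> \<le> (L * C) * \<delta>" using L(1) C xs s t(2) by (intro mult_left_mono) auto
      also have "\<dots> \<le> \<epsilon>' / 2" using \<delta>(4) by (simp add: mult.commute)
      finally have "dist (?f x) (?f t) \<le> \<epsilon>' / 2" by (simp add: dist_norm)
      then show False using xs(3) t(1) dist_triangle[of "?f x" c "?f t"] by simp
    qed
    then show "\<forall>\<^sub>F s in at_left 1. dist (?f s) c < \<epsilon>"
      using t(3) \<epsilon>'(2) by (intro eventually_at_leftI[of t]) (auto intro: less_le_trans)
  qed
qed

lemma eventually_notin_compact_without_cluster:
  assumes K: "compact K" and no: "\<And>c. c \<in> K \<Longrightarrow> \<not> cluster_at_left_1 f c"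
  shows "\<forall>\<^sub>F t in at_left 1. f t \<notin> K"
proof -
  have "\<forall>c\<in>K. \<exists>\<epsilon>>0. \<forall>\<^sub>F t in at_left 1. \<not> dist (f t) c < \<epsilon>"
    using no unfolding cluster_at_left_1_def by (auto simp: not_frequently)
  then obtain e where e: "\<And>c. c \<in> K \<Longrightarrow> e c > 0"
    "\<And>c. c \<in> K \<Longrightarrow> \<forall>\<^sub>F t in at_left 1. \<not> dist (f t) c < e c"
    by metis
  obtain C where C: "C \<subseteq> K" "finite C" "K \<subseteq> (\<Union>c\<in>C. ball c (e c))"
  proof (rule compactE_image[OF K])
    show "K \<subseteq> (\<Union>c\<in>K. ball c (e c))" using e(1) by auto
  qed auto
  have "\<forall>\<^sub>F t in at_left 1. \<forall>c\<in>C. \<not> dist (f t) c < e c"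
    using C e(2) by (intro eventually_ball_finite) auto
  then show ?thesis
  proof eventually_elim
    case (elim t)
    then have "f t \<notin> (\<Union>c\<in>C. ball c (e c))" by (auto simp: dist_commute)
    then show ?case using C(3) by blast
  qed
qed

section \<open>Limits in the Riemann sphere\<close>

lemma limitin_riemann_sphere_Some:
  assumes "(f \<longlongrightarrow> c) F"
  shows "limitin riemann_sphere (\<lambda>t. Some (f t)) (Some c) F"
  unfolding limitin_def riemann_sphere_def
proof (intro conjI allI impI)
  fix U :: "complex option set" assume U: "openin (Alexandroff_compactification euclidean) U \<and> Some c \<in> U"
  then obtain W where W: "open W" "c \<in> W" "Some ` W \<subseteq> U"
  proof -
    have "(\<exists>W. open W \<and> U = Some ` W) \<or> (\<exists>C. compact C \<and> closed C \<and> U = insert None (Some ` (- C)))"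
      using U by (simp add: openin_Alexandroff_compactification Compl_eq_Diff_UNIV)
    then show ?thesis
    proof (elim disjE exE conjE)
      fix W assume "open W" "U = Some ` W"
      then show ?thesis using U that[of W] by auto
    next
      fix C :: "complex set" assume "closed C" "U = insert None (Some ` (- C))"
      then show ?thesis using U that[of "- C"] by auto
    qed
  qed
  show "\<forall>\<^sub>F t in F. Some (f t) \<in> U"
    using topological_tendstoD[OF assms W(1,2)] by eventually_elim (use W(3) in auto)
qed simp

lemma limitin_riemann_sphere_None:
  assumes "\<And>C. compact C \<Longrightarrow> \<forall>\<^sub>F t in F. f t \<notin> C"
  shows "limitin riemann_sphere (\<lambda>t. Some (f t)) None F"
  unfolding limitin_def riemann_sphere_def
proof (intro conjI allI impI)
  fix U :: "complex option set" assume "openin (Alexandroff_compactification euclidean) U \<and> None \<in> U"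
  then obtain C where C: "compact C" "U = insert None (Some ` (- C))"
    by (auto simp: openin_Alexandroff_compactification Compl_eq_Diff_UNIV)
  show "\<forall>\<^sub>F t in F. Some (f t) \<in> U"
    using assms[OF C(1)] by eventually_elim (simp add: C(2))
qed simp

text \<open>The set of limit points of a path in the sphere is connected. A finite limit point
  outside \<open>R\<close> is the limit by assumption; if there is none, the limit points form a connected
  subset of the finite set \<open>R \<union> {\<infinity>}\<close>, which is a single point.\<close>

lemma riemann_sphere_limit_exists:
  assumes f: "continuous_on {0..<1} f" and R: "finite R"
    and lim: "\<And>c. c \<notin> R \<Longrightarrow> cluster_at_left_1 f c \<Longrightarrow> (f \<longlongrightarrow> c) (at_left 1)"
  shows "\<exists>L. limitin riemann_sphere (\<lambda>t. Some (f t)) L (at_left 1)"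
proof (cases "\<exists>c. cluster_at_left_1 f c")
  case False
  then show ?thesis
    using limitin_riemann_sphere_None eventually_notin_compact_without_cluster by blast
next
  case True
  then obtain c where c: "cluster_at_left_1 f c" by blast
  have "\<exists>c. (f \<longlongrightarrow> c) (at_left 1)"
  proof (cases "\<exists>c. c \<notin> R \<and> cluster_at_left_1 f c")
    case True
    then show ?thesis using lim by blast
  next
    case notin: False
    obtain d where d: "d > 0" "\<And>x. x \<in> R \<Longrightarrow> x \<noteq> c \<Longrightarrow> d \<le> dist c x"
      using finite_set_avoid[OF R, of c] by blast
    have "(f \<longlongrightarrow> c) (at_left 1)"
    proof (rule tendstoI)
      fix \<epsilon> :: real assume \<epsilon>: "\<epsilon> > 0"
      \<comment> \<open>The circle of radius \<open>\<rho>\<close> around \<open>c\<close> carries no limit point, hence the path ends up on one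
        side of it, which is the inner one because \<open>c\<close> is a limit point.\<close>
      define \<rho> where "\<rho> = min \<epsilon> d / 2"
      have \<rho>: "\<rho> > 0" "\<rho> < \<epsilon>" "\<rho> < d" using \<epsilon> d(1) by (auto simp: \<rho>_def)
      have "x \<notin> R" if "x \<in> sphere c \<rho>" for x
        using d(2)[of x] that \<rho> by auto
      then have "\<forall>\<^sub>F t in at_left 1. f t \<notin> sphere c \<rho>"
        using notin by (intro eventually_notin_compact_without_cluster) auto
      then obtain b where b: "b < 1" "\<And>t. b < t \<Longrightarrow> t < 1 \<Longrightarrow> f t \<notin> sphere c \<rho>"
        unfolding eventually_at_left_field by blast
      define I where "I = {max b 0<..<1}"
      have "\<forall>\<^sub>F t in at_left (1::real). t \<in> I"
        using b(1) unfolding I_def by (intro eventually_at_leftI[of "max b 0"]) auto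
      moreover have "\<exists>\<^sub>F t in at_left 1. dist (f t) c < \<rho>"
        using c \<rho>(1) unfolding cluster_at_left_1_def by blast
      ultimately have "\<exists>\<^sub>F t in at_left 1. dist (f t) c < \<rho> \<and> t \<in> I"
        by (metis frequently_eventually_frequently)
      then obtain t where t: "dist (f t) c < \<rho>" "t \<in> I" using frequently_ex by blast
      have "continuous_on I f" using f by (rule continuous_on_subset) (auto simp: I_def)
      then have "connected (f ` I)"
        by (rule connected_continuous_image) (simp add: I_def)
      moreover have "f ` I \<inter> frontier (ball c \<rho>) = {}"
        using b(2) \<rho>(1) by (auto simp: I_def)
      moreover have "f ` I \<inter> ball c \<rho> \<noteq> {}" using t by (auto simp: dist_commute)
      ultimately have "f ` I \<subseteq> ball c \<rho>" using connected_Int_frontier by blast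
      then show "\<forall>\<^sub>F t in at_left 1. dist (f t) c < \<epsilon>"
        using b(1) \<rho>(2) by (intro eventually_at_leftI[of "max b 0"]) (force simp: I_def dist_commute)+
    qed
    then show ?thesis by blast
  qed
  then show ?thesis using limitin_riemann_sphere_Some by blast
qed

section \<open>Algebraic curves and graphs\<close>

text \<open>Evaluating the coefficients first: the outer variable of \<open>P\<close> is the one of the points of the
  line, the coefficients are polynomials in the other one.\<close>

lemma poly_poly_const:
  fixes P :: "complex poly poly"
  shows "poly (poly P [:x:]) y = poly (map_poly (\<lambda>c. poly c y) P) x"
  by (induction P) (auto simp: map_poly_pCons)

lemma finite_algebraic_curve_line:
  fixes P :: "complex poly poly"
  assumes "\<exists>x. poly (poly P [:x:]) y \<noteq> 0"
  shows "finite {x. poly (poly P [:x:]) y = 0}"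
proof -
  have "map_poly (\<lambda>c. poly c y) P \<noteq> 0" using assms by (auto simp: poly_poly_const)
  then show ?thesis by (simp add: poly_poly_const poly_roots_finite)
qed

lemma holomorphic_on_poly_graph:
  fixes P :: "complex poly poly"
  assumes "\<omega> holomorphic_on V"
  shows "(\<lambda>v. poly (poly P [:\<omega> v:]) v) holomorphic_on V"
proof (induction P)
  case (pCons q P)
  then show ?case using assms by (auto intro!: holomorphic_intros)
qed simp

lemma continuous_on_poly_poly:
  fixes P :: "complex poly poly"
  shows "continuous_on UNIV (\<lambda>z :: complex \<times> complex. poly (poly P [:fst z:]) (snd z))"
proof (induction P)
  case (pCons q P)
  then show ?case by (auto intro!: continuous_intros)
qed simp

lemma closed_algebraic_curve: "algebraic_curve A \<Longrightarrow> closed A"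
proof -
  assume "algebraic_curve A"
  then obtain P :: "complex poly poly" where "A = {(u, v). poly (poly P [:u:]) v = 0}"
    unfolding algebraic_curve_def by blast
  then have "A = {z. poly (poly P [:fst z:]) (snd z) = 0}" by auto
  then show ?thesis
    using continuous_closed_preimage_constant[OF continuous_on_poly_poly] by simp
qed

text \<open>As soon as the graph of \<open>\<omega>\<close> is not contained in the algebraic curve, it meets the curve only
  over countably many points, and these do not disconnect the domain of \<open>\<omega>\<close>.\<close>

lemma relation_off_algebraic_curve:
  assumes A: "algebraic_curve A" and br: "finitely_branched \<Phi> (- A)"
    and V: "open V" "connected V" and \<omega>: "\<omega> holomorphic_on V"
    and U: "open U" "U \<noteq> {}" "U \<subseteq> V" "\<And>v. v \<in> U \<Longrightarrow> deriv \<omega> v \<in> \<Phi> (\<omega> v, v)"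
    and v: "v \<in> V" "(\<omega> v, v) \<notin> A"
  shows "deriv \<omega> v \<in> \<Phi> (\<omega> v, v)"
proof -
  obtain P :: "complex poly poly" where P: "A = {(u, v). poly (poly P [:u:]) v = 0}"
    using A unfolding algebraic_curve_def by blast
  define q where "q = (\<lambda>v. poly (poly P [:\<omega> v:]) v)"
  have q: "q holomorphic_on V" unfolding q_def using \<omega> by (rule holomorphic_on_poly_graph)
  define E where "E = {v \<in> V. q v = 0}"
  have qA: "(\<omega> v, v) \<in> A \<longleftrightarrow> q v = 0" for v by (simp add: P q_def)
  have "fsigma V"
  proof (rule open_Union_compact_subsets[OF V(1)])
    fix C :: "nat \<Rightarrow> complex set" assume "\<And>n. compact (C n)" "\<Union>(range C) = V"
    then show ?thesis unfolding fsigma_Union_compact by (intro exI[of _ C]) auto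
  qed
  then have "countable E"
    using holomorphic_countable_equal[OF q holomorphic_on_const V, of 0] v qA unfolding E_def by blast
  have "open (V - E)"
  proof -
    have "V - E = V \<inter> q -` (- {0})" by (auto simp: E_def)
    then show ?thesis
      using continuous_open_preimage[OF holomorphic_on_imp_continuous_on[OF q] V(1), of "- {0}"] by auto
  qed
  have conn: "connected (V - E)"
    using V \<open>countable E\<close> by (intro connected_open_diff_countable) auto
  have "uncountable U"
    using U(1,2) uncountable_ball countable_subset by (metis ex_in_conv open_contains_ball)
  then have "U - E \<noteq> {}" using \<open>countable E\<close> countable_subset by auto
  have "U - E = U \<inter> (V - E)" using U(3) by blast
  then have "open (U - E)" using U(1) \<open>open (V - E)\<close> by auto
  show ?thesis
  proof (rule finitely_branched_relation_continuation[OF br \<open>open (V - E)\<close> conn])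
    show "\<omega> holomorphic_on V - E" using \<omega> by (rule holomorphic_on_subset) blast
    show "(\<omega> w, w) \<in> - A" if "w \<in> V - E" for w using that qA by (simp add: E_def)
    show "v \<in> V - E" using v qA by (simp add: E_def)
    show "U - E \<subseteq> V - E" using U(3) by blast
    show "deriv \<omega> w \<in> \<Phi> (\<omega> w, w)" if "w \<in> U - E" for w using that U(4) by blast
  qed (use \<open>U - E \<noteq> {}\<close> \<open>open (U - E)\<close> in auto)
qed

lemma finitely_branched_fibre_values:
  assumes prd: "proper_riemann_domain X \<A> p (- N)" and M: "closedin X M"
    and F: "holomorphic_fun_on \<A> F (topspace X - M)"
  shows "finitely_branched (\<lambda>z. F ` {x \<in> topspace X. p x = z}) (- (N \<union> p ` M))"
  unfolding finitely_branched_def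
proof
  fix y assume y: "y \<in> - (N \<union> p ` M)"
  have T: "openin X (topspace X - M)" using M by blast
  have fib: "{x \<in> topspace X. p x = y} \<subseteq> topspace X - M" and yN: "y \<in> - N" using y by auto
  show "\<exists>B \<G>. open B \<and> y \<in> B \<and> finite \<G> \<and> (\<forall>G\<in>\<G>. holomorphic2_on G B) \<and>
      (\<forall>z\<in>B. F ` {x \<in> topspace X. p x = z} = (\<lambda>G. G z) ` \<G>)"
  proof (rule proper_riemann_domain_branches[OF prd T F yN fib])
    fix B \<G> assume "open B" "y \<in> B" "finite \<G>" "\<And>G. G \<in> \<G> \<Longrightarrow> holomorphic2_on G B"
      "\<And>z. z \<in> B \<Longrightarrow> F ` {x \<in> topspace X. p x = z} = (\<lambda>G. G z) ` \<G>"
    then show ?thesis by (intro exI[of _ B] exI[of _ \<G>]) simp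
  qed
qed

section \<open>The limit of the continuation\<close>

theorem theorem3:
  fixes N :: "(complex \<times> complex) set"
    and X :: "'a topology" and \<A> :: "'a chart set"
    and p :: "'a \<Rightarrow> complex \<times> complex"
    and F :: "'a \<Rightarrow> complex" and M :: "'a set" and X\<^sub>0 :: 'a
    and u\<^sub>0 v\<^sub>0 :: complex
    and a b B K r :: real
    and \<eta> :: "complex \<times> complex \<Rightarrow> 'a"
    and u :: "complex \<Rightarrow> complex"
    and \<gamma> :: "real \<Rightarrow> complex"
    and V :: "complex set" and \<omega> :: "complex \<Rightarrow> complex"
  assumes "curve euclidean C2_atlas N"
    and "proper_riemann_domain X \<A> p (- N)"
    and "curve X \<A> M"
    and "meromorphic_fun X \<A> F"
    and "holomorphic_fun_on \<A> F (topspace X - M)"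
    and "X\<^sub>0 \<in> topspace X - M"
    and "p X\<^sub>0 = (u\<^sub>0, v\<^sub>0)"
    and "0 < a" and "0 < b"
    and "local_inverse X \<A> p (ball u\<^sub>0 b \<times> ball v\<^sub>0 a) \<eta>"
    and "\<eta> (u\<^sub>0, v\<^sub>0) = X\<^sub>0"
    and "holomorphic2_on (F \<circ> \<eta>) (ball u\<^sub>0 b \<times> ball v\<^sub>0 a)"
    and "0 < B" and "0 < K"
    and "\<forall>x\<in>ball u\<^sub>0 b. \<forall>y\<in>ball v\<^sub>0 a. norm (F (\<eta> (x, y))) \<le> B"
    and "\<forall>x\<in>ball u\<^sub>0 b. \<forall>y\<in>ball v\<^sub>0 a. norm (deriv (\<lambda>w. F (\<eta> (w, y))) x) \<le> K"
    and "0 < r" and "r < min a (min (b / B) (1 / K))"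
    and "u holomorphic_on ball v\<^sub>0 r"
    and "u ` ball v\<^sub>0 r \<subseteq> ball u\<^sub>0 b"
    and "\<forall>v\<in>ball v\<^sub>0 r. (u has_field_derivative F (\<eta> (u v, v))) (at v)"
    and "u v\<^sub>0 = u\<^sub>0"
    and "algebraic_curve (N \<union> p ` M)"
    and "arc \<gamma>" and "C1_on_unit_interval \<gamma>" and "\<gamma> 0 = v\<^sub>0"
    and "\<forall>t\<in>{0..1}. \<not> {(x, y). y = \<gamma> t} \<subseteq> N \<union> p ` M"
    and "open V" and "connected V" and "\<gamma> ` {0..<1} \<subseteq> V"
    and "\<omega> holomorphic_on V"
    and "eventually (\<lambda>v. \<omega> v = u v) (nhds v\<^sub>0)"
  shows "\<exists>L. limitin riemann_sphere (\<lambda>t. Some (\<omega> (\<gamma> t))) L (at_left 1)"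
proof -
  let ?A = "N \<union> p ` M"
  let ?\<Phi> = "\<lambda>z. F ` {x \<in> topspace X. p x = z}"
  note prd = assms(2) and curveM = assms(3) and holF = assms(5) and linv = assms(10)
    and ode = assms(21) and alg = assms(23) and C1 = assms(25) and \<gamma>0 = assms(26)
    and lines = assms(27) and V = assms(28,29) and \<gamma>V = assms(30) and \<omega> = assms(31)
    and \<omega>u = assms(32)
  have "closedin X M" using curveM unfolding curve_def analytic_subset_def by blast
  then have br: "finitely_branched ?\<Phi> (- ?A)"
    using finitely_branched_fibre_values[OF prd _ holF] by blast
  have opA: "open (- ?A)" using closed_algebraic_curve[OF alg] by blast
  have v0V: "v\<^sub>0 \<in> V" using \<gamma>V \<gamma>0 by auto
  obtain e where e: "e > 0" "\<And>v. dist v v\<^sub>0 < e \<Longrightarrow> \<omega> v = u v"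
    using \<omega>u unfolding eventually_nhds_metric by blast
  define U where "U = ball v\<^sub>0 e \<inter> ball v\<^sub>0 r \<inter> V"
  have U: "open U" "v\<^sub>0 \<in> U" "U \<subseteq> V" using V(1) e(1) assms(17) v0V by (auto simp: U_def)
  have dU: "deriv \<omega> v \<in> ?\<Phi> (\<omega> v, v)" if v: "v \<in> U" for v
  proof -
    have eq: "\<omega> w = u w" if "w \<in> U" for w
      using e(2) that by (simp add: U_def dist_commute)
    have vr: "v \<in> ball v\<^sub>0 r" using v by (simp add: U_def)
    have "\<forall>\<^sub>F w in nhds v. \<omega> w = u w"
      using eventually_nhds_in_open[OF U(1) v] by eventually_elim (rule eq)
    then have "deriv \<omega> v = deriv u v" by (rule deriv_cong_ev) simp
    also have "\<dots> = F (\<eta> (u v, v))" using ode vr by (blast intro: DERIV_imp_deriv)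
    finally have d: "deriv \<omega> v = F (\<eta> (\<omega> v, v))" using eq[OF v] by simp
    have z: "(\<omega> v, v) \<in> ball u\<^sub>0 b \<times> ball v\<^sub>0 a"
      using assms(20) vr assms(18) eq[OF v] by (auto simp: image_subset_iff)
    have "\<eta> (\<omega> v, v) \<in> topspace X"
      using linv z continuous_map_image_subset_topspace[of "top_of_set (ball u\<^sub>0 b \<times> ball v\<^sub>0 a)" X \<eta>]
      unfolding local_inverse_def holomorphic_into_def by (auto simp: image_subset_iff)
    moreover have "p (\<eta> (\<omega> v, v)) = (\<omega> v, v)"
      using linv z unfolding local_inverse_def by blast
    ultimately show ?thesis using d by blast
  qed
  have rel: "deriv \<omega> v \<in> ?\<Phi> (\<omega> v, v)" if "v \<in> V" "(\<omega> v, v) \<in> - ?A" for v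
    using relation_off_algebraic_curve[OF alg br V \<omega> U(1) _ U(3) dU that(1)] U(2) that(2) by blast
  define R where "R = {c. (c, \<gamma> 1) \<in> ?A}"
  have "finite R"
  proof -
    obtain P :: "complex poly poly" where P: "?A = {(u, v). poly (poly P [:u:]) v = 0}"
      using alg unfolding algebraic_curve_def by blast
    have "\<not> {(x, y). y = \<gamma> 1} \<subseteq> ?A" using lines by simp
    then have "\<exists>x. poly (poly P [:x:]) (\<gamma> 1) \<noteq> 0" unfolding P by auto
    then show ?thesis using finite_algebraic_curve_line unfolding R_def P by simp
  qed
  moreover have "continuous_on {0..<1} (\<lambda>t. \<omega> (\<gamma> t))"
  proof (rule continuous_on_compose2[OF holomorphic_on_imp_continuous_on[OF \<omega>] _ \<gamma>V])
    show "continuous_on {0..<1} \<gamma>"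
      using assms(24) unfolding arc_def path_def by (rule conjE) (auto intro: continuous_on_subset)
  qed
  moreover have "((\<lambda>t. \<omega> (\<gamma> t)) \<longlongrightarrow> c) (at_left 1)"
    if "c \<notin> R" "cluster_at_left_1 (\<lambda>t. \<omega> (\<gamma> t)) c" for c
  proof (rule cluster_point_imp_limit[OF br opA _ V(1) \<gamma>V \<omega> rel C1 that(2)])
    show "(c, \<gamma> 1) \<in> - ?A" using that(1) by (simp add: R_def)
  qed
  ultimately show ?thesis by (intro riemann_sphere_limit_exists)
qed

end
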